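(* Let $G$ be a finite graph (loops and multiple edges allowed), let $\mathfrak{p}\subseteq\Pi(G)$ be a selection of $G$, let $e\in E(G)$, and put $G'=G\setminus e$, $G''=G/e$, with induced selections $\mathfrak{p}'\subseteq \Pi(G')$ and $\mathfrak{p}''\subseteq\Pi(G'')$. The partition-selected chromatic, tension, flow and Tutte polynomials satisfy $$\chi_G(\mathfrak{p},t)=\begin{cases} 0,&\text{if } e \text{ is a loop};\\ \chi_{G'}(\mathfrak{p}',t)-\chi_{G''}(\mathfrak{p}'',t),&\text{otherwise},\end{cases}$$ $$\tau_G(\mathfrak{p},t)=\begin{cases} 0,&\text{if } e \text{ is a loop};\\ t\,\tau_{G'}(\mathfrak{p}',t)-\tau_{G''}(\mathfrak{p}'',t),&\text{if } e \text{ is a cut-edge};\\ \tau_{G'}(\mathfrak{p}',t)-\tau_{G''}(\mathfrak{p}'',t),&\text{otherwise},\end{cases}$$ $$\varphi_G(\mathfrak{p},t)=\begin{cases} (t-1)\varphi_{G'}(\mathfrak{p}',t),&\text{if } e \text{ is a loop};\\ \varphi_{G''}(\mathfrak{p}'',t)-\varphi_{G'}(\mathfrak{p}',t),&\text{otherwise},\end{cases}$$ $$T_G(\mathfrak{p};x,y)=\begin{cases} y\,T_{G'}(\mathfrak{p}';x,y),&\text{if } e \text{ is a loop};\\ (x-1)T_{G'}(\mathfrak{p}';x,y)+T_{G''}(\mathfrak{p}'';x,y),&\text{if } e \text{ is a cut-edge};\\ T_{G'}(\mathfrak{p}';x,y)+T_{G''}(\mathfrak{p}'';x,y),&\text{otherwise}.\end{cases}$$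 Moreover, the partition-selected chromatic and tension polynomials are related by $\chi_G(\mathfrak{p},t)=t^{c(G)}\tau_G(\mathfrak{p},t)$.
   Context: For a finite graph $G=(V(G),E(G))$ and $S\subseteq E(G)$, put $S^c=E(G)\smallsetminus S$, let $c(S)$ be the number of connected components of the spanning subgraph $(V(G),S)$, $r(S)=|V(G)|-c(S)$, $n(S)=|S|-r(S)$; $c(G),r(G),n(G)$ denote the values at $S=E(G)$. Let $\pi(S)$ be the partition of $V(G)$ into the vertex sets of the components of $(V(G),S)$, and $\Pi(G)=\{\pi(S):S\subseteq E(G)\}$ (equivalently, the set of partitions of $V(G)$ each of whose blocks induces a connected subgraph of $G$). A selection of $G$ is a subset $\mathfrak{p}\subseteq\Pi(G)$. Partition-selected polynomials: $\chi_G(\mathfrak{p},t)=\sum_{S\subseteq E(G),\,\pi(S)\in\mathfrak{p}}(-1)^{|S|}t^{c(S)}$, $\tau_G(\mathfrak{p},t)=\sum_{S\subseteq E(G),\,\pi(S)\in\mathfrak{p}}(-1)^{|S|}t^{r(G)-r(S)}$, $\varphi_G(\mathfrak{p},t)=\sum_{S\subseteq E(G),\,\pi(S)\in\mathfrak{p}}(-1)^{|S^c|}t^{n(S)}$, $R_G(\mathfrak{p};x,y)=\sum_{S\subseteq E(G),\,\pi(S)\in\mathfrak{p}}x^{r(G)-r(S)}y^{n(S)}$, $T_G(\mathfrak{p};x,y)=R_G(\mathfrak{p};x-1,y-1)$. All are $0$ when $\mathfrak{p}=\emptyset$. Deletion/contraction: $G'=G\setminus e$ is obtained by deleting $e$;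 $G''=G/e$ is obtained by identifying the ends $u,v$ of $e$ into one vertex and removing $e$ (so $G''=G'$ if $e$ is a loop). A cut-edge is an edge contained in no cycle (a loop is a cycle). Let $\Pi_e(G)$ be the set of $\pi\in\Pi(G)$ such that $u$ and $v$ lie in the same block of $\pi$. Then $\mathfrak{p}'=\mathfrak{p}\cap\Pi(G')$ and $\mathfrak{p}''=\{\pi/e:\pi\in\mathfrak{p}\cap\Pi_e(G)\}\subseteq\Pi(G'')$, where $\pi/e$ is the partition of $V(G'')$ obtained from $\pi$ by identifying $u$ and $v$ into the single new vertex. *)

theory Defs
  imports Main
begin

text \<open>Finite undirected multigraphs. An edge is incident with the set of its ends, so a loop is an
  edge with exactly one end, and parallel edges are distinct edges with the same set of ends.\<close>

record ('v, 'e) mgraph =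
  verts :: "'v set"
  edges :: "'e set"
  ends :: "'e \<Rightarrow> 'v set"

definition finite_graph :: "('v, 'e) mgraph \<Rightarrow> bool" where
  "finite_graph G \<longleftrightarrow> finite (verts G) \<and> finite (edges G) \<and>
     (\<forall>e\<in>edges G. ends G e \<subseteq> verts G \<and> card (ends G e) \<in> {1, 2})"

definition is_loop :: "('v, 'e) mgraph \<Rightarrow> 'e \<Rightarrow> bool" where
  "is_loop G e \<longleftrightarrow> e \<in> edges G \<and> card (ends G e) = 1"

text \<open>The cycle runs \<open>vs!0, es!0, vs!1, es!1, \<dots>, vs!(k-1), es!(k-1), vs!0\<close>. The case
  \<open>k = 1\<close> is a loop and the case \<open>k = 2\<close> is a pair of parallel edges.\<close>

definition is_cycle :: "('v, 'e) mgraph \<Rightarrow> 'v list \<Rightarrow> 'e list \<Rightarrow> bool" where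
  "is_cycle G vs es \<longleftrightarrow> es \<noteq> [] \<and> length vs = length es \<and> distinct vs \<and> distinct es \<and>
     set vs \<subseteq> verts G \<and> set es \<subseteq> edges G \<and>
     (\<forall>i<length es. ends G (es ! i) = {vs ! i, vs ! (Suc i mod length vs)})"

definition is_cut_edge :: "('v, 'e) mgraph \<Rightarrow> 'e \<Rightarrow> bool" where
  "is_cut_edge G e \<longleftrightarrow> e \<in> edges G \<and> \<not> (\<exists>vs es. is_cycle G vs es \<and> e \<in> set es)"

definition adjacent :: "('v, 'e) mgraph \<Rightarrow> 'e set \<Rightarrow> ('v \<times> 'v) set" where
  "adjacent G S = {(u, v). \<exists>e\<in>S. ends G e = {u, v}}"

definition connected_in :: "('v, 'e) mgraph \<Rightarrow> 'e set \<Rightarrow> ('v \<times> 'v) set" where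
  "connected_in G S = {(u, v) \<in> verts G \<times> verts G. (u, v) \<in> (adjacent G S)\<^sup>*}"

text \<open>\<open>component_partition G S\<close> is $\pi(S)$, the set of vertex sets of the connected components
  of the spanning subgraph with edge set \<open>S\<close>.\<close>

definition component_partition :: "('v, 'e) mgraph \<Rightarrow> 'e set \<Rightarrow> 'v set set" where
  "component_partition G S = verts G // connected_in G S"

definition num_components :: "('v, 'e) mgraph \<Rightarrow> 'e set \<Rightarrow> nat" where
  "num_components G S = card (component_partition G S)"

text \<open>The subtractions below, and \<open>rank G (edges G) - rank G S\<close> in the polynomials, are on \<open>nat\<close>.
  For a finite graph and \<open>S \<subseteq> edges G\<close> none of them truncates.\<close>

definition rank :: "('v, 'e) mgraph \<Rightarrow> 'e set \<Rightarrow> nat" where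
  "rank G S = card (verts G) - num_components G S"

definition nullity :: "('v, 'e) mgraph \<Rightarrow> 'e set \<Rightarrow> nat" where
  "nullity G S = card S - rank G S"

definition connected_partitions :: "('v, 'e) mgraph \<Rightarrow> 'v set set set" where
  "connected_partitions G = {component_partition G S | S. S \<subseteq> edges G}"

definition is_selection :: "('v, 'e) mgraph \<Rightarrow> 'v set set set \<Rightarrow> bool" where
  "is_selection G p \<longleftrightarrow> p \<subseteq> connected_partitions G"

definition selected_sets :: "('v, 'e) mgraph \<Rightarrow> 'v set set set \<Rightarrow> 'e set set" where
  "selected_sets G p = {S. S \<subseteq> edges G \<and> component_partition G S \<in> p}"

text \<open>The polynomials are evaluated at elements of an arbitrary commutative ring. Taking the
  indeterminates of an iterated polynomial ring over \<open>int\<close> as arguments gives the polynomials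
  themselves, so an identity for all commutative rings contains the identity of polynomials.\<close>

definition chromatic :: "('v, 'e) mgraph \<Rightarrow> 'v set set set \<Rightarrow> 'a::comm_ring_1 \<Rightarrow> 'a" where
  "chromatic G p t = (\<Sum>S\<in>selected_sets G p. (-1) ^ card S * t ^ num_components G S)"

definition tension :: "('v, 'e) mgraph \<Rightarrow> 'v set set set \<Rightarrow> 'a::comm_ring_1 \<Rightarrow> 'a" where
  "tension G p t =
     (\<Sum>S\<in>selected_sets G p. (-1) ^ card S * t ^ (rank G (edges G) - rank G S))"

definition flow :: "('v, 'e) mgraph \<Rightarrow> 'v set set set \<Rightarrow> 'a::comm_ring_1 \<Rightarrow> 'a" where
  "flow G p t = (\<Sum>S\<in>selected_sets G p. (-1) ^ card (edges G - S) * t ^ nullity G S)"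

definition rank_generating ::
    "('v, 'e) mgraph \<Rightarrow> 'v set set set \<Rightarrow> 'a::comm_ring_1 \<Rightarrow> 'a \<Rightarrow> 'a" where
  "rank_generating G p x y =
     (\<Sum>S\<in>selected_sets G p. x ^ (rank G (edges G) - rank G S) * y ^ nullity G S)"

definition tutte :: "('v, 'e) mgraph \<Rightarrow> 'v set set set \<Rightarrow> 'a::comm_ring_1 \<Rightarrow> 'a \<Rightarrow> 'a" where
  "tutte G p x y = rank_generating G p (x - 1) (y - 1)"

definition deletion :: "('v, 'e) mgraph \<Rightarrow> 'e \<Rightarrow> ('v, 'e) mgraph" where
  "deletion G e = G\<lparr>edges := edges G - {e}\<rparr>"

text \<open>The vertex of \<open>G / e\<close> obtained by identifying the ends of \<open>e\<close> is named by one of these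
  ends. In particular \<open>G / e\<close> and \<open>G \ e\<close> have the same vertices, edges and ends if \<open>e\<close> is a loop.\<close>

definition merge_ends :: "('v, 'e) mgraph \<Rightarrow> 'e \<Rightarrow> 'v \<Rightarrow> 'v" where
  "merge_ends G e w = (if w \<in> ends G e then (SOME u. u \<in> ends G e) else w)"

definition contraction :: "('v, 'e) mgraph \<Rightarrow> 'e \<Rightarrow> ('v, 'e) mgraph" where
  "contraction G e =
     \<lparr>verts = merge_ends G e ` verts G,
      edges = edges G - {e},
      ends = (\<lambda>f. merge_ends G e ` ends G f)\<rparr>"

definition joining_partitions :: "('v, 'e) mgraph \<Rightarrow> 'e \<Rightarrow> 'v set set set" where
  "joining_partitions G e = {P \<in> connected_partitions G. \<exists>B\<in>P. ends G e \<subseteq> B}"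

definition contract_partition :: "('v, 'e) mgraph \<Rightarrow> 'e \<Rightarrow> 'v set set \<Rightarrow> 'v set set" where
  "contract_partition G e P = (\<lambda>B. merge_ends G e ` B) ` P"

definition deletion_selection ::
    "('v, 'e) mgraph \<Rightarrow> 'e \<Rightarrow> 'v set set set \<Rightarrow> 'v set set set" where
  "deletion_selection G e p = p \<inter> connected_partitions (deletion G e)"

definition contraction_selection ::
    "('v, 'e) mgraph \<Rightarrow> 'e \<Rightarrow> 'v set set set \<Rightarrow> 'v set set set" where
  "contraction_selection G e p = contract_partition G e ` (p \<inter> joining_partitions G e)"

end

theory Submission imports Defs begin

text \<open>Each polynomial is a sum over edge sets \<open>S\<close> with \<open>\<pi>(S)\<close> selected. Split this sum according to
  whether \<open>e \<in> S\<close>. The sets that avoid \<open>e\<close> are exactly the selected sets of the deletion, since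
  deleting \<open>e\<close> changes neither \<open>\<pi>(S)\<close> nor any count attached to \<open>S\<close> alone
  (\<open>sum_selected_sets_split\<close>). If \<open>e\<close> is not a loop, the sets containing \<open>e\<close> correspond by
  \<open>S \<mapsto> S - {e}\<close> to the selected sets of the contraction: \<open>\<pi>(S)\<close> has both ends of \<open>e\<close> in one block,
  merging the ends carries it to the partition of \<open>S - {e}\<close> in the contraction
  (\<open>component_partition_contraction\<close>), and on partitions with both ends in one block this merging
  loses no information (\<open>inj_on_contract_partition\<close>), so membership in the selection is preserved
  in both directions. If \<open>e\<close> is a loop, \<open>S\<close> and \<open>S \<union> {e}\<close> have the same components and the terms
  of such a pair differ by a fixed factor.

  What remains is to compare exponents. All of them are expressed by numbers of components, and these
  are governed by one fact: adding an edge replaces the blocks of its two ends by their union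
  (\<open>component_partition_insert\<close>), so it lowers the number of components by one or leaves it alone.
  The deletion of \<open>e\<close> alters the rank of the whole graph precisely if \<open>e\<close> is a cut-edge, that is,
  if its ends are not joined by a path avoiding \<open>e\<close> (\<open>is_cut_edge_iff\<close>). Hence the exponent
  \<open>r(G) - r(S)\<close> of a set avoiding \<open>e\<close> drops by one on deletion of a cut-edge, which gives the extra
  factor in the tension and Tutte recursions.\<close>

section \<open>Components of spanning subgraphs\<close>

lemma adjacent_sym: "(x, y) \<in> adjacent G S \<longleftrightarrow> (y, x) \<in> adjacent G S"
  by (auto simp: adjacent_def insert_commute)

lemma reachable_sym: "(x, y) \<in> (adjacent G S)\<^sup>* \<longleftrightarrow> (y, x) \<in> (adjacent G S)\<^sup>*"
proof -
  have "sym ((adjacent G S)\<^sup>*)"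
    by (intro sym_rtrancl symI) (simp add: adjacent_sym)
  then show ?thesis by (auto dest: symD)
qed

lemma equiv_connected_in: "equiv (verts G) (connected_in G S)"
  unfolding connected_in_def
  by (intro equivI refl_onI symI transI) (auto intro: reachable_sym[THEN iffD1])

lemma connected_in_Image:
  assumes "x \<in> verts G"
  shows "connected_in G S `` {x} = {y \<in> verts G. (x, y) \<in> (adjacent G S)\<^sup>*}"
  using assms by (auto simp: connected_in_def)

lemma component_partition_eq_image:
  "component_partition G S = (\<lambda>x. {y \<in> verts G. (x, y) \<in> (adjacent G S)\<^sup>*}) ` verts G"
  by (auto simp: component_partition_def quotient_def connected_in_Image)

lemma finite_component_partition:
  "finite (verts G) \<Longrightarrow> finite (component_partition G S)"
  by (simp add: component_partition_eq_image)

lemma num_components_le_card_verts: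
  "finite (verts G) \<Longrightarrow> num_components G S \<le> card (verts G)"
  by (simp add: num_components_def component_partition_eq_image card_image_le)

lemma num_components_empty: "num_components G {} = card (verts G)"
proof -
  have "(adjacent G {})\<^sup>* = Id"
    by (simp add: adjacent_def)
  then have "{y \<in> verts G. (x, y) \<in> (adjacent G {})\<^sup>*} = {x}" if "x \<in> verts G" for x
    using that by auto
  then have "component_partition G {} = (\<lambda>x. {x}) ` verts G"
    by (simp add: component_partition_eq_image cong: image_cong_simp)
  then show ?thesis
    by (simp add: num_components_def card_image)
qed

lemma finite_graph_ends:
  assumes "finite_graph G" "e \<in> edges G"
  obtains u v where "ends G e = {u, v}" "u \<in> verts G" "v \<in> verts G" "is_loop G e \<longleftrightarrow> u = v"
proof -
  have "ends G e \<subseteq> verts G" "card (ends G e) = 1 \<or> card (ends G e) = 2"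
    using assms by (auto simp: finite_graph_def)
  then show ?thesis
    using that assms(2) by (auto simp: is_loop_def card_1_singleton_iff card_2_iff)
qed

section \<open>Adding one edge\<close>

text \<open>A walk that uses the new edge can be shortened so that it uses it once, in one of its two
  directions.\<close>

lemma reachable_insert_iff:
  fixes G :: "('v, 'e) mgraph" and S :: "'e set"
  assumes "ends G e = {u, v}"
  defines "R \<equiv> (adjacent G S)\<^sup>*"
  shows "(x, y) \<in> (adjacent G (insert e S))\<^sup>* \<longleftrightarrow>
    (x, y) \<in> R \<or> (x, u) \<in> R \<and> (v, y) \<in> R \<or> (x, v) \<in> R \<and> (u, y) \<in> R"
proof -
  have adj: "adjacent G (insert e S) = insert (u, v) (insert (v, u) (adjacent G S))"
    using assms(1) by (auto simp: adjacent_def doubleton_eq_iff)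
  have trans: "(a, b) \<in> R \<Longrightarrow> (b, c) \<in> R \<Longrightarrow> (a, c) \<in> R" for a b c
    unfolding R_def by (rule rtrancl_trans)
  show ?thesis
    unfolding adj rtrancl_insert R_def[symmetric] by (auto intro: trans)
qed

lemma component_partition_insert_redundant:
  assumes "ends G e = {u, v}" "(u, v) \<in> (adjacent G S)\<^sup>*"
  shows "component_partition G (insert e S) = component_partition G S"
proof -
  have "(v, u) \<in> (adjacent G S)\<^sup>*" using assms(2) by (simp add: reachable_sym)
  then have "(adjacent G (insert e S))\<^sup>* = (adjacent G S)\<^sup>*"
    using assms(2) by (auto simp: reachable_insert_iff[OF assms(1)] intro: rtrancl_trans)
  then show ?thesis by (simp add: component_partition_eq_image)
qed

lemma component_partition_insert:
  fixes G :: "('v, 'e) mgraph" and S :: "'e set"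
  assumes "ends G e = {u, v}" "u \<in> verts G" "v \<in> verts G"
  defines "K \<equiv> \<lambda>x. {y \<in> verts G. (x, y) \<in> (adjacent G S)\<^sup>*}"
  shows "component_partition G (insert e S) =
    insert (K u \<union> K v) (component_partition G S - {K u, K v})"
proof -
  define R where "R = (adjacent G S)\<^sup>*"
  define K' where "K' = (\<lambda>x. {y \<in> verts G. (x, y) \<in> (adjacent G (insert e S))\<^sup>*})"
  have refl: "(a, a) \<in> R" for a
    by (simp add: R_def)
  have sym: "(a, b) \<in> R \<Longrightarrow> (b, a) \<in> R" for a b
    by (simp add: R_def reachable_sym)
  have trans: "(a, b) \<in> R \<Longrightarrow> (b, c) \<in> R \<Longrightarrow> (a, c) \<in> R" for a b c
    unfolding R_def by (rule rtrancl_trans)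
  have K: "y \<in> K x \<longleftrightarrow> y \<in> verts G \<and> (x, y) \<in> R" for x y
    by (simp add: K_def R_def)
  have K': "y \<in> K' x \<longleftrightarrow> y \<in> verts G \<and>
      ((x, y) \<in> R \<or> (x, u) \<in> R \<and> (v, y) \<in> R \<or> (x, v) \<in> R \<and> (u, y) \<in> R)" for x y
    by (simp add: K'_def R_def reachable_insert_iff[OF assms(1)])
  have cong: "(x, y) \<in> R \<longleftrightarrow> (z, y) \<in> R" if "(x, z) \<in> R" for x y z
    using that sym trans by metis
  have K_eq: "K x = K z" if "(x, z) \<in> R" for x z
    using cong[OF that] by (simp add: K_def flip: R_def)
  have near: "K' x = K u \<union> K v" if "(x, u) \<in> R \<or> (x, v) \<in> R" for x
  proof (intro set_eqI)
    fix y show "y \<in> K' x \<longleftrightarrow> y \<in> K u \<union> K v"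
      using that cong[of x u y] cong[of x v y] by (auto simp: K K')
  qed
  have far: "K' x = K x" if "(x, u) \<notin> R" "(x, v) \<notin> R" for x
    using that by (auto simp: K K')
  have end_block: "K x = K u \<or> K x = K v \<longleftrightarrow> (x, u) \<in> R \<or> (x, v) \<in> R" if "x \<in> verts G" for x
  proof
    assume "K x = K u \<or> K x = K v"
    moreover have "x \<in> K x" using that refl by (simp add: K)
    ultimately have "x \<in> K u \<or> x \<in> K v" by auto
    then show "(x, u) \<in> R \<or> (x, v) \<in> R" using sym by (auto simp: K)
  next
    assume "(x, u) \<in> R \<or> (x, v) \<in> R"
    then show "K x = K u \<or> K x = K v" using K_eq by blast
  qed
  have "K' ` verts G = insert (K u \<union> K v) (K ` verts G - {K u, K v})" (is "?L = ?M")
  proof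
    show "?L \<subseteq> ?M"
    proof (intro image_subsetI)
      fix x assume "x \<in> verts G"
      then show "K' x \<in> ?M" using near[of x] far[of x] end_block[of x] by auto
    qed
    have "K u \<union> K v \<in> ?L" using near[of u] refl assms(2) by (metis image_eqI)
    moreover have "K x \<in> ?L" if "x \<in> verts G" "K x \<noteq> K u" "K x \<noteq> K v" for x
      using that far[of x] end_block[of x] by (metis image_eqI)
    ultimately show "?M \<subseteq> ?L" by blast
  qed
  then show ?thesis
    by (simp add: component_partition_eq_image K_def K'_def)
qed

lemma num_components_insert:
  assumes "finite (verts G)" "ends G e = {u, v}" "u \<in> verts G" "v \<in> verts G"
  shows "num_components G S =
    num_components G (insert e S) + (if (u, v) \<in> (adjacent G S)\<^sup>* then 0 else 1)"
proof (cases "(u, v) \<in> (adjacent G S)\<^sup>*")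
  case True
  then show ?thesis
    by (simp add: num_components_def component_partition_insert_redundant[OF assms(2)])
next
  case False
  define K where "K = (\<lambda>x. {y \<in> verts G. (x, y) \<in> (adjacent G S)\<^sup>*})"
  let ?P = "component_partition G S"
  have P: "?P = K ` verts G" by (simp add: K_def component_partition_eq_image)
  have fin: "finite ?P" using assms(1) by (rule finite_component_partition)
  have mem: "K u \<in> ?P" "K v \<in> ?P" using assms(3,4) P by auto
  have "v \<notin> K u" "v \<in> K v" "u \<in> K u" using False assms(3,4) by (auto simp: K_def)
  then have distinct: "K u \<noteq> K v" by auto
  have new: "K u \<union> K v \<notin> ?P - {K u, K v}"
  proof
    assume "K u \<union> K v \<in> ?P - {K u, K v}"
    then obtain x where x: "K x = K u \<union> K v" "x \<in> verts G" using P by auto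
    then have "(x, u) \<in> (adjacent G S)\<^sup>*" "(x, v) \<in> (adjacent G S)\<^sup>*"
      using \<open>u \<in> K u\<close> \<open>v \<in> K v\<close> by (auto simp: K_def)
    then show False using False reachable_sym rtrancl_trans by metis
  qed
  have "card {K u, K v} \<le> card ?P"
    using fin mem by (intro card_mono) auto
  then have "card ?P = card (insert (K u \<union> K v) (?P - {K u, K v})) + 1"
    using fin mem distinct new by (simp add: card_Diff_subset)
  then show ?thesis
    using False by (simp add: num_components_def component_partition_insert[OF assms(2-4)] K_def)
qed

lemma num_components_insert_bounds:
  assumes "finite_graph G" "e \<in> edges G"
  shows "num_components G (insert e S) \<le> num_components G S"
    and "num_components G S \<le> Suc (num_components G (insert e S))"
proof -
  obtain u v where "ends G e = {u, v}" "u \<in> verts G" "v \<in> verts G"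
    using finite_graph_ends[OF assms] .
  from num_components_insert[OF _ this, of S] assms(1)
  show "num_components G (insert e S) \<le> num_components G S"
    and "num_components G S \<le> Suc (num_components G (insert e S))"
    by (auto simp: finite_graph_def split: if_splits)
qed

lemma num_components_antimono:
  assumes "finite_graph G" "S \<subseteq> T" "T \<subseteq> edges G"
  shows "num_components G T \<le> num_components G S"
proof -
  have "num_components G (S \<union> A) \<le> num_components G S" if "finite A" "A \<subseteq> edges G" for A
    using that
  proof (induction A rule: finite_induct)
    case empty
    then show ?case by simp
  next
    case (insert e A)
    then show ?case
      using num_components_insert_bounds(1)[OF assms(1), of e "S \<union> A"] by auto
  qed
  from this[of T] show ?thesis
    using assms by (auto simp: finite_graph_def Un_absorb1 dest: finite_subset)
qed

text \<open>The forest bound \<open>r(S) \<le> |S|\<close>, which keeps the nullity from being truncated.\<close>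

lemma rank_le_card:
  assumes "finite_graph G" "S \<subseteq> edges G"
  shows "rank G S \<le> card S"
proof -
  have "finite S" using assms by (auto simp: finite_graph_def dest: finite_subset)
  then have "card (verts G) \<le> num_components G S + card S"
    using assms(2)
  proof (induction S rule: finite_induct)
    case empty
    then show ?case by (simp add: num_components_empty)
  next
    case (insert e S)
    then show ?case
      using num_components_insert_bounds(2)[OF assms(1), of e S] by auto
  qed
  then show ?thesis by (simp add: rank_def)
qed

lemma corank_eq:
  assumes "finite (verts G)"
  shows "rank G (edges G) - rank G S = num_components G S - num_components G (edges G)"
  using num_components_le_card_verts[OF assms, of S]
    num_components_le_card_verts[OF assms, of "edges G"]
  by (simp add: rank_def)

section \<open>Cut-edges\<close>

text \<open>Walks are shortened to paths while they are built: if the next vertex has been visited before,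
  the path is cut back to that vertex.\<close>

lemma reachable_imp_path:
  assumes "(u, v) \<in> (adjacent G S)\<^sup>*"
  shows "\<exists>n f g. inj_on f {..n} \<and> f 0 = u \<and> f n = v \<and>
    (\<forall>i<n. g i \<in> S \<and> ends G (g i) = {f i, f (Suc i)})"
  using assms
proof (induction rule: rtrancl_induct)
  case base
  show ?case by (intro exI[of _ 0] exI[of _ "\<lambda>_. u"]) simp
next
  case (step v w)
  then obtain n f g where path: "inj_on f {..n}" "f 0 = u" "f n = v"
    "\<forall>i<n. g i \<in> S \<and> ends G (g i) = {f i, f (Suc i)}" by blast
  show ?case
  proof (cases "w \<in> f ` {..n}")
    case True
    then obtain k where "k \<le> n" "f k = w" by auto
    then have "inj_on f {..k} \<and> f 0 = u \<and> f k = w \<and>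
        (\<forall>i<k. g i \<in> S \<and> ends G (g i) = {f i, f (Suc i)})"
      using path by (auto intro: inj_on_subset)
    then show ?thesis by blast
  next
    case False
    obtain e where e: "e \<in> S" "ends G e = {v, w}"
      using step.hyps by (auto simp: adjacent_def)
    let ?f = "f(Suc n := w)" and ?g = "g(n := e)"
    have "inj_on ?f {..Suc n}"
      using path(1) False by (auto simp: inj_on_def atMost_Suc)
    moreover have "\<forall>i<Suc n. ?g i \<in> S \<and> ends G (?g i) = {?f i, ?f (Suc i)}"
      using path e by (auto simp: less_Suc_eq)
    ultimately show ?thesis
      using path(2) by (intro exI[of _ "Suc n"] exI[of _ ?f] exI[of _ ?g] conjI)
        (simp_all only: fun_upd_same fun_upd_other nat.distinct simp_thms)
  qed
qed

lemma cycle_imp_ends_reachable: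
  assumes "is_cycle G vs es" "e \<in> set es" "ends G e = {u, v}"
  shows "(u, v) \<in> (adjacent G (edges G - {e}))\<^sup>*"
proof -
  define k where "k = length es"
  obtain j where j: "j < k" "es ! j = e"
    using assms(2) by (auto simp: in_set_conv_nth k_def)
  have cyc: "length vs = k" "distinct es" "set es \<subseteq> edges G"
    "\<And>i. i < k \<Longrightarrow> ends G (es ! i) = {vs ! i, vs ! (Suc i mod k)}"
    using assms(1) by (auto simp: is_cycle_def k_def)
  have step: "(vs ! i, vs ! (Suc i mod k)) \<in> adjacent G (edges G - {e})" if "i < k" "i \<noteq> j" for i
  proof -
    have "es ! i \<in> edges G - {e}"
      using that j cyc by (auto simp: k_def nth_eq_iff_index_eq)
    then show ?thesis using cyc(4)[OF that(1)] by (auto simp: adjacent_def)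
  qed
  \<comment> \<open>Walk around the cycle from the head of \<open>e\<close>; the remaining \<open>k - 1\<close> edges lead to its tail.\<close>
  have walk: "(vs ! (Suc j mod k), vs ! ((Suc j + n) mod k)) \<in> (adjacent G (edges G - {e}))\<^sup>*"
    if "n \<le> k - 1" for n
    using that
  proof (induction n)
    case 0
    then show ?case by simp
  next
    case (Suc n)
    let ?i = "(Suc j + n) mod k"
    have "?i \<noteq> j"
    proof (cases "Suc j + n < k")
      case False
      then have "?i = Suc j + n - k"
        using Suc.prems j by (simp add: mod_if)
      then show ?thesis using Suc.prems j False by simp
    qed simp
    moreover have "?i < k" using j by simp
    ultimately have "(vs ! ?i, vs ! (Suc ?i mod k)) \<in> adjacent G (edges G - {e})"
      by (rule step[rotated])
    moreover have "Suc ?i mod k = (Suc j + Suc n) mod k" by (simp add: mod_simps)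
    ultimately show ?case using Suc by (auto intro: rtrancl_into_rtrancl)
  qed
  have "(Suc j + (k - 1)) mod k = j" using j by (simp add: mod_if)
  with walk[of "k - 1"] have "(vs ! (Suc j mod k), vs ! j) \<in> (adjacent G (edges G - {e}))\<^sup>*"
    by simp
  moreover have "{u, v} = {vs ! j, vs ! (Suc j mod k)}"
    using cyc(4)[OF j(1)] j(2) assms(3) by simp
  ultimately show ?thesis
    by (auto simp: doubleton_eq_iff reachable_sym)
qed

text \<open>A path between the ends that avoids \<open>e\<close> is closed up by \<open>e\<close> to a cycle.\<close>

lemma is_cut_edge_iff:
  assumes "finite_graph G" "e \<in> edges G" "ends G e = {u, v}"
  shows "is_cut_edge G e \<longleftrightarrow> (u, v) \<notin> (adjacent G (edges G - {e}))\<^sup>*"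
proof
  assume cut: "is_cut_edge G e"
  show "(u, v) \<notin> (adjacent G (edges G - {e}))\<^sup>*"
  proof
    assume "(u, v) \<in> (adjacent G (edges G - {e}))\<^sup>*"
    from reachable_imp_path[OF this] obtain n f g where path:
      "inj_on f {..n}" "f 0 = u" "f n = v"
      "\<And>i. i < n \<Longrightarrow> g i \<in> edges G - {e}" "\<And>i. i < n \<Longrightarrow> ends G (g i) = {f i, f (Suc i)}"
      by blast
    \<comment> \<open>The path has \<open>n + 1\<close> vertices and \<open>n\<close> edges; \<open>e\<close> leads back from the last vertex to the first.\<close>
    define h where "h = g(n := e)"
    let ?vs = "map f [0..<Suc n]" and ?es = "map h [0..<Suc n]"
    have "inj_on f {0..<Suc n}"
      using path(1) by (simp add: atLeast0LessThan lessThan_Suc_atMost)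
    then have "distinct ?vs" by (simp only: distinct_map distinct_upt set_upt simp_thms)
    have "inj_on g {..<n}"
    proof (intro inj_onI)
      fix i j assume ij: "i \<in> {..<n}" "j \<in> {..<n}" "g i = g j"
      then have "{f i, f (Suc i)} = {f j, f (Suc j)}" using path(5)[of i] path(5)[of j] by simp
      moreover have "f a = f b \<longleftrightarrow> a = b" if "a \<le> n" "b \<le> n" for a b
        using path(1) that by (auto simp: inj_on_eq_iff)
      ultimately show "i = j" using ij by (auto simp: doubleton_eq_iff)
    qed
    moreover have "e \<notin> g ` {..<n}" using path(4) by auto
    ultimately have "inj_on h {0..<Suc n}"
      by (simp add: h_def atLeast0LessThan lessThan_Suc inj_on_fun_updI)
    then have "distinct ?es" by (simp only: distinct_map distinct_upt set_upt simp_thms)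
    have h: "h i \<in> edges G" if "i \<le> n" for i
      using that path(4) assms(2) by (auto simp: h_def le_less)
    have ends_h: "ends G (h i) = {f i, f (Suc i mod Suc n)}" if "i \<le> n" for i
      using that path assms(3) by (auto simp: h_def le_less)
    have "f i \<in> verts G" if "i \<le> n" for i
      using h[OF that] ends_h[OF that] assms(1) by (auto simp: finite_graph_def)
    then have "set ?vs \<subseteq> verts G" by auto
    moreover have "set ?es \<subseteq> edges G" using h by auto
    moreover have "\<forall>i<length ?es. ends G (?es ! i) = {?vs ! i, ?vs ! (Suc i mod length ?vs)}"
      using ends_h by (simp del: upt_Suc)
    ultimately have "is_cycle G ?vs ?es"
      unfolding is_cycle_def using \<open>distinct ?vs\<close> \<open>distinct ?es\<close> by (simp del: upt_Suc)
    moreover have "e \<in> set ?es" by (simp add: h_def)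
    ultimately show False using cut unfolding is_cut_edge_def by blast
  qed
next
  assume "(u, v) \<notin> (adjacent G (edges G - {e}))\<^sup>*"
  then show "is_cut_edge G e"
    using cycle_imp_ends_reachable[OF _ _ assms(3)] assms(2) by (auto simp: is_cut_edge_def)
qed

lemma num_components_remove_edge:
  assumes "finite_graph G" "e \<in> edges G"
  shows "num_components G (edges G - {e}) =
    num_components G (edges G) + (if is_cut_edge G e then 1 else 0)"
proof -
  obtain u v where uv: "ends G e = {u, v}" "u \<in> verts G" "v \<in> verts G"
    using finite_graph_ends[OF assms] .
  have "finite (verts G)" using assms(1) by (simp add: finite_graph_def)
  from num_components_insert[OF this uv, of "edges G - {e}"] show ?thesis
    using is_cut_edge_iff[OF assms uv(1)] assms(2) by (simp add: insert_absorb)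
qed

section \<open>Deletion\<close>

lemma deletion_simps [simp]:
  "verts (deletion G e) = verts G"
  "edges (deletion G e) = edges G - {e}"
  "component_partition (deletion G e) S = component_partition G S"
  "num_components (deletion G e) S = num_components G S"
  "rank (deletion G e) S = rank G S"
  "nullity (deletion G e) S = nullity G S"
  by (simp_all add: deletion_def component_partition_def connected_in_def adjacent_def
      num_components_def rank_def nullity_def)

lemma selected_sets_deletion:
  "selected_sets (deletion G e) (deletion_selection G e p) =
    {S. S \<subseteq> edges G - {e} \<and> component_partition G S \<in> p}"
  by (auto simp: selected_sets_def deletion_selection_def connected_partitions_def)

lemma sum_selected_sets_split:
  assumes "finite_graph G" "e \<in> edges G"
  shows "(\<Sum>S\<in>selected_sets G p. f S) =
    (\<Sum>S\<in>selected_sets (deletion G e) (deletion_selection G e p). f S) +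
    (\<Sum>S\<in>{S. S \<subseteq> edges G - {e} \<and> component_partition G (insert e S) \<in> p}. f (insert e S))"
    (is "_ = sum f ?A + sum _ ?B")
proof -
  have fin: "finite (Pow (edges G))" using assms(1) by (simp add: finite_graph_def)
  have "selected_sets G p = ?A \<union> insert e ` ?B" (is "?L = ?R")
  proof
    show "?L \<subseteq> ?R"
    proof
      fix S assume S: "S \<in> ?L"
      show "S \<in> ?R"
      proof (cases "e \<in> S")
        case True
        then have restore: "insert e (S - {e}) = S" by auto
        then have "S - {e} \<in> ?B"
          using S unfolding selected_sets_def mem_Collect_eq restore by blast
        then have "insert e (S - {e}) \<in> insert e ` ?B" by (rule imageI)
        then show ?thesis unfolding restore by (rule UnI2)
      next
        case False
        with S show ?thesis
          unfolding selected_sets_deletion by (auto simp: selected_sets_def)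
      qed
    qed
    show "?R \<subseteq> ?L"
      unfolding selected_sets_deletion using assms(2) by (auto simp: selected_sets_def)
  qed
  moreover have "?A \<inter> insert e ` ?B = {}" by (auto simp: selected_sets_deletion)
  moreover have "finite ?A" "finite ?B"
    by (auto intro: finite_subset[OF _ fin] simp: selected_sets_deletion)
  moreover have "inj_on (insert e) ?B"
    by (intro inj_onI) (auto simp: insert_ident)
  ultimately show ?thesis
    by (simp add: sum.union_disjoint sum.reindex)
qed

section \<open>Contraction\<close>

lemma merge_ends_in_ends: "w \<in> ends G e \<Longrightarrow> merge_ends G e w \<in> ends G e"
  unfolding merge_ends_def by (metis someI)

lemma merge_ends_eqD:
  "merge_ends G e x = merge_ends G e y \<Longrightarrow> x = y \<or> x \<in> ends G e \<and> y \<in> ends G e"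
  using merge_ends_in_ends[of _ G e] by (metis merge_ends_def)

lemma merge_ends_const: "x \<in> ends G e \<Longrightarrow> y \<in> ends G e \<Longrightarrow> merge_ends G e x = merge_ends G e y"
  by (simp add: merge_ends_def)

lemma reachable_merge_ends:
  assumes "ends G e = {u, v}"
  shows "(x, merge_ends G e x) \<in> (adjacent G (insert e S))\<^sup>*"
proof (cases "x \<in> ends G e")
  case True
  have "(u, v) \<in> adjacent G (insert e S)" using assms by (auto simp: adjacent_def)
  then have "(a, b) \<in> (adjacent G (insert e S))\<^sup>*" if "a \<in> ends G e" "b \<in> ends G e" for a b
    using that adjacent_sym[of u v G "insert e S"] by (auto simp: assms)
  then show ?thesis using True merge_ends_in_ends[OF True] by blast
qed (simp add: merge_ends_def)

text \<open>Walks in the contraction lift to walks in \<open>G\<close> by inserting \<open>e\<close> where necessary, and walks in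
  \<open>G\<close> project to the contraction, where the steps along \<open>e\<close> become stationary.\<close>

lemma reachable_contraction_iff:
  fixes G :: "('v, 'e) mgraph"
  assumes "finite_graph G" "e \<in> edges G" "S \<subseteq> edges G"
  shows "(merge_ends G e x, merge_ends G e y) \<in> (adjacent (contraction G e) S)\<^sup>* \<longleftrightarrow>
    (x, y) \<in> (adjacent G (insert e S))\<^sup>*"
proof -
  obtain u v where uv: "ends G e = {u, v}" using finite_graph_ends[OF assms(1,2)] .
  let ?m = "merge_ends G e" and ?R = "(adjacent G (insert e S))\<^sup>*"
    and ?Q = "(adjacent (contraction G e) S)\<^sup>*"
  have near: "(z, ?m z) \<in> ?R" "(?m z, z) \<in> ?R" for z
    by (rule reachable_merge_ends[OF uv]) (subst reachable_sym, rule reachable_merge_ends[OF uv])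
  have lift: "(a, b) \<in> ?R" if "(a, b) \<in> adjacent (contraction G e) S" for a b
  proof -
    obtain f where f: "f \<in> S" "?m ` ends G f = {a, b}"
      using \<open>(a, b) \<in> _\<close> by (auto simp: adjacent_def contraction_def)
    have "f \<in> edges G" using assms(3) f(1) by auto
    from finite_graph_ends[OF assms(1) this] obtain c d where "ends G f = {c, d}" .
    then have cd: "(c, d) \<in> ?R" "(d, c) \<in> ?R"
      using f(1) by (auto simp: adjacent_def intro!: r_into_rtrancl)
    have "{?m c, ?m d} = {a, b}" using f(2) \<open>ends G f = {c, d}\<close> by simp
    then consider "a = ?m c" "b = ?m d" | "a = ?m d" "b = ?m c"
      by (auto simp: doubleton_eq_iff)
    then show ?thesis
    proof cases
      case 1
      then show ?thesis using rtrancl_trans[OF rtrancl_trans[OF near(2) cd(1)] near(1)] by simp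
    next
      case 2
      then show ?thesis using rtrancl_trans[OF rtrancl_trans[OF near(2) cd(2)] near(1)] by simp
    qed
  qed
  have project: "(?m a, ?m b) \<in> ?Q" if "(a, b) \<in> adjacent G (insert e S)" for a b
  proof -
    obtain f where f: "f \<in> insert e S" "ends G f = {a, b}"
      using \<open>(a, b) \<in> _\<close> by (auto simp: adjacent_def)
    show ?thesis
    proof (cases "f = e")
      case True
      then have "?m a = ?m b" using f(2) by (intro merge_ends_const) auto
      then show ?thesis by simp
    next
      case False
      then have "(?m a, ?m b) \<in> adjacent (contraction G e) S"
        using f by (auto simp: adjacent_def contraction_def)
      then show ?thesis by blast
    qed
  qed
  show ?thesis
  proof
    assume "(?m x, ?m y) \<in> ?Q"
    moreover have "?Q \<subseteq> ?R" by (rule rtrancl_subset_rtrancl) (use lift in auto)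
    ultimately have "(?m x, ?m y) \<in> ?R" by (rule rev_subsetD)
    then show "(x, y) \<in> ?R" by (rule rtrancl_trans[OF rtrancl_trans[OF near(1)] near(2)])
  next
    assume "(x, y) \<in> ?R"
    then show "(?m x, ?m y) \<in> ?Q"
    proof induction
      case base
      show ?case by simp
    next
      case (step y z)
      then show ?case using rtrancl_trans[OF step.IH project] by simp
    qed
  qed
qed

lemma component_partition_contraction:
  assumes "finite_graph G" "e \<in> edges G" "S \<subseteq> edges G"
  shows "component_partition (contraction G e) S =
    contract_partition G e (component_partition G (insert e S))"
proof -
  let ?m = "merge_ends G e"
  have "{z \<in> ?m ` verts G. (?m x, z) \<in> (adjacent (contraction G e) S)\<^sup>*} =
      ?m ` {y \<in> verts G. (x, y) \<in> (adjacent G (insert e S))\<^sup>*}" for x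
    using reachable_contraction_iff[OF assms] by blast
  moreover have "verts (contraction G e) = ?m ` verts G" by (simp add: contraction_def)
  ultimately show ?thesis
    by (simp add: component_partition_eq_image contract_partition_def image_image)
qed

lemma component_partition_insert_joining:
  assumes "finite_graph G" "e \<in> edges G" "S \<subseteq> edges G"
  shows "component_partition G (insert e S) \<in> joining_partitions G e"
proof -
  obtain u v where uv: "ends G e = {u, v}" "u \<in> verts G" "v \<in> verts G"
    using finite_graph_ends[OF assms(1,2)] .
  have "(u, v) \<in> (adjacent G (insert e S))\<^sup>*"
    using uv(1) by (auto simp: adjacent_def)
  then have "ends G e \<subseteq> {y \<in> verts G. (u, y) \<in> (adjacent G (insert e S))\<^sup>*}"
    using uv by auto
  then show ?thesis
    using assms uv(2)
    by (auto simp: joining_partitions_def connected_partitions_def component_partition_eq_image)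
qed

text \<open>The blocks of a partition that joins the ends of \<open>e\<close> are saturated for the merging map, so each
  of them is the preimage of its image.\<close>

lemma joining_block_eq_vimage:
  assumes "P \<in> joining_partitions G e" "B \<in> P"
  shows "{w \<in> verts G. merge_ends G e w \<in> merge_ends G e ` B} = B"
proof -
  obtain S B0 where P: "P = component_partition G S" and B0: "B0 \<in> P" "ends G e \<subseteq> B0"
    using assms(1) by (auto simp: joining_partitions_def connected_partitions_def)
  have "B = B0 \<or> B \<inter> B0 = {}"
    using quotient_disj[OF equiv_connected_in] assms(2) B0(1)
    by (simp add: P component_partition_def)
  moreover have "B \<subseteq> verts G"
    using assms(2) by (auto simp: P component_partition_eq_image)
  ultimately show ?thesis
    using B0(2) by (auto dest!: merge_ends_eqD)
qed

lemma inj_on_contract_partition: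
  "inj_on (contract_partition G e) (joining_partitions G e)"
proof (rule inj_on_inverseI)
  fix P assume P: "P \<in> joining_partitions G e"
  show "(\<lambda>C. {w \<in> verts G. merge_ends G e w \<in> C}) ` contract_partition G e P = P"
    by (simp add: contract_partition_def image_image joining_block_eq_vimage[OF P])
qed

lemma num_components_contraction:
  assumes "finite_graph G" "e \<in> edges G" "S \<subseteq> edges G"
  shows "num_components (contraction G e) S = num_components G (insert e S)"
proof -
  let ?P = "component_partition G (insert e S)"
  have "inj_on (\<lambda>B. merge_ends G e ` B) ?P"
    by (rule inj_on_inverseI[where g = "\<lambda>C. {w \<in> verts G. merge_ends G e w \<in> C}"])
      (rule joining_block_eq_vimage[OF component_partition_insert_joining[OF assms]])
  then show ?thesis
    by (simp add: num_components_def component_partition_contraction[OF assms]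
        contract_partition_def card_image)
qed

lemma card_verts_contraction:
  assumes "finite_graph G" "e \<in> edges G" "\<not> is_loop G e"
  shows "card (verts G) = Suc (card (verts (contraction G e)))"
proof -
  obtain u v where uv: "ends G e = {u, v}" "u \<in> verts G" "v \<in> verts G" "is_loop G e \<longleftrightarrow> u = v"
    using finite_graph_ends[OF assms(1,2)] .
  then have "u \<noteq> v" using assms(3) by simp
  let ?m = "merge_ends G e"
  have eq: "?m u = ?m v" using uv(1) by (simp add: merge_ends_const)
  have inj: "inj_on ?m (verts G - {u})"
  proof (rule inj_onI)
    fix x y assume "x \<in> verts G - {u}" "y \<in> verts G - {u}" "?m x = ?m y"
    then show "x = y" using merge_ends_eqD[of G e x y] uv(1) by auto
  qed
  have "verts G = insert u (verts G - {u})" using uv(2) by auto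
  then have "?m ` verts G = insert (?m u) (?m ` (verts G - {u}))" by (metis image_insert)
  also have "\<dots> = ?m ` (verts G - {u})"
    unfolding eq using uv(3) \<open>u \<noteq> v\<close> by (intro insert_absorb imageI) simp
  finally have "verts (contraction G e) = ?m ` (verts G - {u})" by (simp add: contraction_def)
  with inj have "card (verts (contraction G e)) = card (verts G - {u})"
    by (simp only: card_image)
  moreover have "finite (verts G)" using assms(1) by (simp add: finite_graph_def)
  ultimately show ?thesis
    using uv(2) by (simp only: card.remove)
qed

lemma corank_contraction:
  assumes "finite_graph G" "e \<in> edges G" "S \<subseteq> edges G"
  shows "rank (contraction G e) (edges (contraction G e)) - rank (contraction G e) S =
    rank G (edges G) - rank G (insert e S)"
proof -
  have fin: "finite (verts G)" "finite (verts (contraction G e))"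
    using assms(1) by (simp_all add: finite_graph_def contraction_def)
  have "num_components (contraction G e) (edges G - {e}) = num_components G (edges G)"
    using num_components_contraction[OF assms(1,2), of "edges G - {e}"] assms(2)
    by (auto simp: insert_absorb)
  moreover have "edges (contraction G e) = edges G - {e}" by (simp add: contraction_def)
  ultimately show ?thesis
    unfolding corank_eq[OF fin(1)] corank_eq[OF fin(2)] num_components_contraction[OF assms]
    by simp
qed

text \<open>Both \<open>|S|\<close> and the rank grow by one when the edge is put back: the number of components is the
  same and the vertex count is one larger. As \<open>c \<le> |V|\<close> holds in the contraction, the rank is
  not truncated there, so the two changes cancel.\<close>

lemma nullity_contraction:
  assumes "finite_graph G" "e \<in> edges G" "\<not> is_loop G e" "S \<subseteq> edges G - {e}"
  shows "nullity (contraction G e) S = nullity G (insert e S)"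
proof -
  have S: "S \<subseteq> edges G" "finite S" "e \<notin> S"
    using assms(1,4) by (auto simp: finite_graph_def dest: finite_subset)
  have "finite (verts (contraction G e))"
    using assms(1) by (simp add: finite_graph_def contraction_def)
  from num_components_le_card_verts[OF this, of S]
  have "num_components G (insert e S) \<le> card (verts (contraction G e))"
    by (simp add: num_components_contraction[OF assms(1,2) S(1)])
  then show ?thesis
    using card_verts_contraction[OF assms(1-3)] S(2,3)
    by (simp add: nullity_def rank_def num_components_contraction[OF assms(1,2) S(1)])
qed

text \<open>Injectivity of contracting partitions is needed for the inclusion from left to right: a
  partition in the contracted selection might otherwise stem from a selected partition different from
  that of \<open>S \<union> {e}\<close>.\<close>

lemma selected_sets_contraction:
  assumes "finite_graph G" "e \<in> edges G" "is_selection G p"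
  shows "selected_sets (contraction G e) (contraction_selection G e p) =
    {S. S \<subseteq> edges G - {e} \<and> component_partition G (insert e S) \<in> p}"
proof -
  have "component_partition (contraction G e) S \<in> contraction_selection G e p \<longleftrightarrow>
      component_partition G (insert e S) \<in> p" if "S \<subseteq> edges G - {e}" for S
  proof -
    have S: "S \<subseteq> edges G" using that by auto
    note joining = component_partition_insert_joining[OF assms(1,2) S]
    show ?thesis
      unfolding component_partition_contraction[OF assms(1,2) S] contraction_selection_def
      using inj_on_image_mem_iff[OF inj_on_contract_partition joining, of "p \<inter> joining_partitions G e"]
        joining by simp
  qed
  then show ?thesis
    by (auto simp: selected_sets_def contraction_def)
qed

section \<open>Deletion and contraction for the selected polynomials\<close>

text \<open>The two summation lemmas below reduce each recursion to a comparison of single terms. For a loop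
  the sets with and without \<open>e\<close> are paired, as both are selected or neither is.\<close>

lemma sum_selected_sets_loop:
  fixes f :: "'e set \<Rightarrow> 'a::comm_ring_1"
  assumes "finite_graph G" "is_loop G e"
    and "\<And>S. S \<subseteq> edges G - {e} \<Longrightarrow>
      component_partition G (insert e S) = component_partition G S \<Longrightarrow> f S + f (insert e S) = c * g S"
  shows "(\<Sum>S\<in>selected_sets G p. f S) =
    c * (\<Sum>S\<in>selected_sets (deletion G e) (deletion_selection G e p). g S)"
proof -
  have e: "e \<in> edges G" using assms(2) by (simp add: is_loop_def)
  obtain u where u: "ends G e = {u, u}"
    using finite_graph_ends[OF assms(1) e] assms(2) by auto
  have loop: "component_partition G (insert e S) = component_partition G S" for S
    using component_partition_insert_redundant[OF u] by simp
  show ?thesis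
    unfolding sum_selected_sets_split[OF assms(1) e] selected_sets_deletion loop
      sum.distrib[symmetric] sum_distrib_left
    using assms(3) loop by (intro sum.cong) auto
qed

lemma sum_selected_sets_nonloop:
  fixes f :: "'e set \<Rightarrow> 'a::comm_ring_1"
  assumes "finite_graph G" "is_selection G p" "e \<in> edges G"
    and "\<And>S. S \<subseteq> edges G - {e} \<Longrightarrow> f S = c * g S"
    and "\<And>S. S \<subseteq> edges G - {e} \<Longrightarrow> f (insert e S) = d * h S"
  shows "(\<Sum>S\<in>selected_sets G p. f S) =
    c * (\<Sum>S\<in>selected_sets (deletion G e) (deletion_selection G e p). g S) +
    d * (\<Sum>S\<in>selected_sets (contraction G e) (contraction_selection G e p). h S)"
  unfolding sum_selected_sets_split[OF assms(1,3)] selected_sets_deletion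
    selected_sets_contraction[OF assms(1,3,2)] sum_distrib_left
  using assms(4,5) by (intro arg_cong2[where f = "(+)"] sum.cong) auto

context
  fixes G :: "('v, 'e) mgraph" and e :: 'e
  assumes G: "finite_graph G" and e: "e \<in> edges G"
begin

lemma card_insert_edge: "S \<subseteq> edges G - {e} \<Longrightarrow> card (insert e S) = Suc (card S)"
  using G by (subst card_insert_disjoint) (auto simp: finite_graph_def dest: finite_subset)

lemma card_compl_edge:
  assumes "S \<subseteq> edges G - {e}"
  shows "card (edges G - S) = Suc (card (edges G - {e} - S))"
proof -
  have "finite (edges G - S)" "e \<in> edges G - S"
    using G e assms by (auto simp: finite_graph_def)
  moreover have "edges G - S - {e} = edges G - {e} - S" by auto
  ultimately show ?thesis by (metis card.remove)
qed

lemma compl_insert_edge: "edges G - insert e S = edges G - {e} - S"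
  by auto

text \<open>The comparison of \<open>c(S)\<close> with the number of components of the whole graph is where cut-edges
  enter.\<close>

lemma corank_deletion:
  assumes "S \<subseteq> edges G - {e}"
  shows "rank G (edges G) - rank G S =
    (rank G (edges G - {e}) - rank G S) + (if is_cut_edge G e then 1 else 0)"
proof -
  have fin: "finite (verts G)" using G by (simp add: finite_graph_def)
  have "num_components G (edges G - {e}) \<le> num_components G S"
    using assms by (intro num_components_antimono[OF G]) auto
  moreover have "rank G (edges G - {e}) - rank G S =
      num_components G S - num_components G (edges G - {e})"
    using corank_eq[of "deletion G e" S] fin by simp
  ultimately show ?thesis
    using num_components_remove_edge[OF G e] by (auto simp: corank_eq[OF fin])
qed

context
  assumes loop: "is_loop G e"
begin

lemma loop_not_cut_edge: "\<not> is_cut_edge G e"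
proof -
  obtain u where "ends G e = {u, u}" using finite_graph_ends[OF G e] loop by auto
  from is_cut_edge_iff[OF G e this] show ?thesis by simp
qed

lemma nullity_insert_loop:
  assumes "S \<subseteq> edges G - {e}"
    and "component_partition G (insert e S) = component_partition G S"
  shows "nullity G (insert e S) = Suc (nullity G S)"
proof -
  have "rank G S \<le> card S" using assms(1) by (intro rank_le_card[OF G]) auto
  then show ?thesis
    using assms by (simp add: nullity_def rank_def num_components_def card_insert_edge)
qed

lemma chromatic_loop: "chromatic G p t = 0"
proof -
  have "chromatic G p t =
      0 * (\<Sum>S\<in>selected_sets (deletion G e) (deletion_selection G e p). 0)"
    unfolding chromatic_def
    by (rule sum_selected_sets_loop[OF G loop]) (simp add: card_insert_edge num_components_def)
  then show ?thesis by simp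
qed

lemma tension_loop: "tension G p t = 0"
proof -
  have "tension G p t =
      0 * (\<Sum>S\<in>selected_sets (deletion G e) (deletion_selection G e p). 0)"
    unfolding tension_def
    by (rule sum_selected_sets_loop[OF G loop])
      (simp add: card_insert_edge num_components_def rank_def)
  then show ?thesis by simp
qed

lemma flow_loop:
  "flow G p t = (t - 1) * flow (deletion G e) (deletion_selection G e p) t"
  unfolding flow_def
proof (rule sum_selected_sets_loop[OF G loop])
  fix S assume S: "S \<subseteq> edges G - {e}"
    "component_partition G (insert e S) = component_partition G S"
  show "(- 1) ^ card (edges G - S) * t ^ nullity G S +
      (- 1) ^ card (edges G - insert e S) * t ^ nullity G (insert e S) =
      (t - 1) * ((- 1) ^ card (edges (deletion G e) - S) * t ^ nullity (deletion G e) S)"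
    unfolding card_compl_edge[OF S(1)] compl_insert_edge[of S] nullity_insert_loop[OF S]
      deletion_simps
    by (simp add: algebra_simps)
qed

lemma tutte_loop:
  "tutte G p x y = y * tutte (deletion G e) (deletion_selection G e p) x y"
  unfolding tutte_def rank_generating_def
proof (rule sum_selected_sets_loop[OF G loop])
  fix S assume S: "S \<subseteq> edges G - {e}"
    "component_partition G (insert e S) = component_partition G S"
  have "rank G (insert e S) = rank G S" using S(2) by (simp add: rank_def num_components_def)
  then show "(x - 1) ^ (rank G (edges G) - rank G S) * (y - 1) ^ nullity G S +
      (x - 1) ^ (rank G (edges G) - rank G (insert e S)) * (y - 1) ^ nullity G (insert e S) =
      y * ((x - 1) ^ (rank (deletion G e) (edges (deletion G e)) - rank (deletion G e) S) *
        (y - 1) ^ nullity (deletion G e) S)"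
    using S by (simp add: corank_deletion nullity_insert_loop loop_not_cut_edge algebra_simps)
qed

end

context
  fixes p :: "'v set set set"
  assumes p: "is_selection G p" and nonloop: "\<not> is_loop G e"
begin

lemma chromatic_nonloop:
  "chromatic G p t = chromatic (deletion G e) (deletion_selection G e p) t -
    chromatic (contraction G e) (contraction_selection G e p) t"
proof -
  have "chromatic G p t = 1 * chromatic (deletion G e) (deletion_selection G e p) t +
      (-1) * chromatic (contraction G e) (contraction_selection G e p) t"
    unfolding chromatic_def
  proof (rule sum_selected_sets_nonloop[OF G p e])
    fix S assume S: "S \<subseteq> edges G - {e}"
    then have "S \<subseteq> edges G" by auto
    then show "(- 1) ^ card (insert e S) * t ^ num_components G (insert e S) =
        - 1 * ((- 1) ^ card S * t ^ num_components (contraction G e) S)"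
      by (simp add: card_insert_edge[OF S] num_components_contraction[OF G e])
  qed simp
  then show ?thesis by simp
qed

lemma tension_nonloop:
  "tension G p t =
    (if is_cut_edge G e then t else 1) * tension (deletion G e) (deletion_selection G e p) t -
    tension (contraction G e) (contraction_selection G e p) t"
proof -
  have "tension G p t =
      (if is_cut_edge G e then t else 1) * tension (deletion G e) (deletion_selection G e p) t +
      (-1) * tension (contraction G e) (contraction_selection G e p) t"
    unfolding tension_def
  proof (rule sum_selected_sets_nonloop[OF G p e])
    fix S assume S: "S \<subseteq> edges G - {e}"
    then show "(- 1) ^ card S * t ^ (rank G (edges G) - rank G S) =
        (if is_cut_edge G e then t else 1) * ((- 1) ^ card S *
          t ^ (rank (deletion G e) (edges (deletion G e)) - rank (deletion G e) S))"
      by (simp add: corank_deletion)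
    from S have "S \<subseteq> edges G" by auto
    then show "(- 1) ^ card (insert e S) * t ^ (rank G (edges G) - rank G (insert e S)) =
        - 1 * ((- 1) ^ card S *
          t ^ (rank (contraction G e) (edges (contraction G e)) - rank (contraction G e) S))"
      by (simp add: card_insert_edge[OF S] corank_contraction[OF G e])
  qed
  then show ?thesis by simp
qed

lemma flow_nonloop:
  "flow G p t = flow (contraction G e) (contraction_selection G e p) t -
    flow (deletion G e) (deletion_selection G e p) t"
proof -
  have "flow G p t = (-1) * flow (deletion G e) (deletion_selection G e p) t +
      1 * flow (contraction G e) (contraction_selection G e p) t"
    unfolding flow_def
  proof (rule sum_selected_sets_nonloop[OF G p e])
    fix S assume S: "S \<subseteq> edges G - {e}"
    show "(- 1) ^ card (edges G - S) * t ^ nullity G S =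
        - 1 * ((- 1) ^ card (edges (deletion G e) - S) * t ^ nullity (deletion G e) S)"
      unfolding card_compl_edge[OF S] deletion_simps by simp
    show "(- 1) ^ card (edges G - insert e S) * t ^ nullity G (insert e S) =
        1 * ((- 1) ^ card (edges (contraction G e) - S) * t ^ nullity (contraction G e) S)"
      unfolding compl_insert_edge[of S] nullity_contraction[OF G e nonloop S]
      by (simp add: contraction_def)
  qed
  then show ?thesis by simp
qed

lemma tutte_nonloop:
  "tutte G p x y =
    (if is_cut_edge G e then x - 1 else 1) * tutte (deletion G e) (deletion_selection G e p) x y +
    tutte (contraction G e) (contraction_selection G e p) x y"
proof -
  have "tutte G p x y =
      (if is_cut_edge G e then x - 1 else 1) *
        tutte (deletion G e) (deletion_selection G e p) x y +
      1 * tutte (contraction G e) (contraction_selection G e p) x y"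
    unfolding tutte_def rank_generating_def
  proof (rule sum_selected_sets_nonloop[OF G p e])
    fix S assume S: "S \<subseteq> edges G - {e}"
    then show "(x - 1) ^ (rank G (edges G) - rank G S) * (y - 1) ^ nullity G S =
        (if is_cut_edge G e then x - 1 else 1) *
          ((x - 1) ^ (rank (deletion G e) (edges (deletion G e)) - rank (deletion G e) S) *
            (y - 1) ^ nullity (deletion G e) S)"
      by (simp add: corank_deletion mult.assoc)
    from S have "S \<subseteq> edges G" by auto
    then show "(x - 1) ^ (rank G (edges G) - rank G (insert e S)) *
          (y - 1) ^ nullity G (insert e S) =
        1 * ((x - 1) ^ (rank (contraction G e) (edges (contraction G e)) -
            rank (contraction G e) S) * (y - 1) ^ nullity (contraction G e) S)"
      by (simp add: corank_contraction[OF G e] nullity_contraction[OF G e nonloop S])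
  qed
  then show ?thesis by simp
qed

end

end

text \<open>Since \<open>r(G) - r(S) = c(S) - c(G)\<close> and \<open>c(G) \<le> c(S)\<close>, the two polynomials agree term by term
  after a shift by \<open>c(G)\<close>.\<close>

lemma chromatic_eq_tension:
  assumes "finite_graph G"
  shows "chromatic G p t = t ^ num_components G (edges G) * tension G p t"
proof -
  have fin: "finite (verts G)" using assms by (simp add: finite_graph_def)
  have "t ^ num_components G S = t ^ num_components G (edges G) *
      t ^ (rank G (edges G) - rank G S)" if "S \<in> selected_sets G p" for S
    using that num_components_antimono[OF assms, of S "edges G"]
    by (simp add: selected_sets_def corank_eq[OF fin] flip: power_add)
  then show ?thesis
    by (simp add: chromatic_def tension_def sum_distrib_left mult.left_commute)
qed

theorem theorem2p1:
  fixes G :: "('v, 'e) mgraph"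
    and p :: "'v set set set"
    and t x y :: "'a::comm_ring_1"
  assumes "finite_graph G"
    and "is_selection G p"
  shows
    "(\<forall>e\<in>edges G.
       let G' = deletion G e; p' = deletion_selection G e p;
           G'' = contraction G e; p'' = contraction_selection G e p
       in
         chromatic G p t =
           (if is_loop G e then 0
            else chromatic G' p' t - chromatic G'' p'' t) \<and>
         tension G p t =
           (if is_loop G e then 0
            else if is_cut_edge G e then t * tension G' p' t - tension G'' p'' t
            else tension G' p' t - tension G'' p'' t) \<and>
         flow G p t =
           (if is_loop G e then (t - 1) * flow G' p' t
            else flow G'' p'' t - flow G' p' t) \<and>
         tutte G p x y =
           (if is_loop G e then y * tutte G' p' x y
            else if is_cut_edge G e then (x - 1) * tutte G' p' x y + tutte G'' p'' x y
            else tutte G' p' x y + tutte G'' p'' x y)) \<and>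
     chromatic G p t = t ^ num_components G (edges G) * tension G p t"
  unfolding Let_def
proof (intro conjI ballI)
  fix e assume e: "e \<in> edges G"
  note nonloop = assms(1) e assms(2)
  show "chromatic G p t =
      (if is_loop G e then 0
       else chromatic (deletion G e) (deletion_selection G e p) t -
         chromatic (contraction G e) (contraction_selection G e p) t)"
    by (simp add: chromatic_loop[OF assms(1) e] chromatic_nonloop[OF nonloop])
  show "tension G p t =
      (if is_loop G e then 0
       else if is_cut_edge G e
         then t * tension (deletion G e) (deletion_selection G e p) t -
           tension (contraction G e) (contraction_selection G e p) t
       else tension (deletion G e) (deletion_selection G e p) t -
         tension (contraction G e) (contraction_selection G e p) t)"
    by (simp add: tension_loop[OF assms(1) e] tension_nonloop[OF nonloop])
  show "flow G p t =
      (if is_loop G e then (t - 1) * flow (deletion G e) (deletion_selection G e p) t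
       else flow (contraction G e) (contraction_selection G e p) t -
         flow (deletion G e) (deletion_selection G e p) t)"
    by (simp add: flow_loop[OF assms(1) e] flow_nonloop[OF nonloop])
  show "tutte G p x y =
      (if is_loop G e then y * tutte (deletion G e) (deletion_selection G e p) x y
       else if is_cut_edge G e
         then (x - 1) * tutte (deletion G e) (deletion_selection G e p) x y +
           tutte (contraction G e) (contraction_selection G e p) x y
       else tutte (deletion G e) (deletion_selection G e p) x y +
         tutte (contraction G e) (contraction_selection G e p) x y)"
    by (simp add: tutte_loop[OF assms(1) e] tutte_nonloop[OF nonloop])
next
  show "chromatic G p t = t ^ num_components G (edges G) * tension G p t"
    by (rule chromatic_eq_tension[OF assms(1)])
qed

end
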